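(* Let $m,n\ge 3$ and $p\ge 1$ be integers with $p\le R(m,n)-1$, and let $\alpha,\beta,\gamma,\delta$ be integers with $\alpha\ge R(m-2,n)-1$, $\beta\ge R(m,n-2)-1$, $\gamma\ge R(m-1,n)-1$ and $\delta\ge R(m,n-1)-1$. Then $$e(m,n;p)\ge \max\left\{\frac{p(p-\delta-1)}{2},\ \frac{A-\sqrt{A^2-B}}{12}\right\}$$ and $$E(m,n;p)\le \min\left\{\frac{p\gamma}{2},\ \frac{A+\sqrt{A^2-B}}{12}\right\},$$ where $$A=(\alpha-\beta+3(p-1))\,p,\qquad B=12p^2(p-1)(p-\beta-2).$$
   Context: All graphs are finite, simple and undirected. For positive integers $m,n$, an $(m,n)$-graph is a graph containing no clique of size $m$ and no independent set of size $n$ (sizes count vertices). An $(m,n;p)$-graph is an $(m,n)$-graph of order $p$, i.e. with exactly $p$ vertices. The two-colour Ramsey number $R(m,n)$ is the least natural number $p$ such that there is no $(m,n;p)$-graph; in particular $R(1,n)=R(m,1)=1$. Whenever an $(m,n;p)$-graph exists (which is the case when $p\le R(m,n)-1$), $e(m,n;p)$ and $E(m,n;p)$ denote respectively the minimum and the maximum number of edges in an $(m,n;p)$-graph. *)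

theory Defs
  imports Complex_Main "HOL-Library.Ramsey"
begin

definition simple_graph :: "'a set \<Rightarrow> 'a set set \<Rightarrow> bool" where
  "simple_graph V E \<longleftrightarrow> finite V \<and> E \<subseteq> nsets V 2"

definition ramsey_graph :: "nat \<Rightarrow> nat \<Rightarrow> 'a set \<Rightarrow> 'a set set \<Rightarrow> bool" where
  "ramsey_graph m n V E \<longleftrightarrow> simple_graph V E \<and>
     \<not> (\<exists>S \<subseteq> V. card S = m \<and> clique S E) \<and>
     \<not> (\<exists>S \<subseteq> V. card S = n \<and> indep S E)"

text \<open>
  From here on vertices are natural numbers. This is no restriction: every finite graph is
  isomorphic to one whose vertices are natural numbers.
\<close>

definition ramsey_graph_of_order :: "nat \<Rightarrow> nat \<Rightarrow> nat \<Rightarrow> nat set \<Rightarrow> nat set set \<Rightarrow> bool" where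
  "ramsey_graph_of_order m n p V E \<longleftrightarrow> ramsey_graph m n V E \<and> card V = p"

text \<open>
  Some order \<open>p\<close> admits no such graph, by Ramsey's theorem, so \<open>LEAST\<close> is meaningful for all \<open>m\<close> and \<open>n\<close>.
  For positive \<open>m\<close> and \<open>n\<close> the empty graph shows that the value is at least 1.
\<close>

definition ramsey_number :: "nat \<Rightarrow> nat \<Rightarrow> nat" where
  "ramsey_number m n = (LEAST p. \<not> (\<exists>V E. ramsey_graph_of_order m n p V E))"

text \<open>
  The sets of edge counts are finite, the counts being at most \<open>p choose 2\<close>; so the minimum and
  the maximum are the intended ones as soon as some such graph of order \<open>p\<close> exists.
\<close>

definition min_edges :: "nat \<Rightarrow> nat \<Rightarrow> nat \<Rightarrow> nat" where
  "min_edges m n p = Min {card E | V E. ramsey_graph_of_order m n p V E}"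

definition max_edges :: "nat \<Rightarrow> nat \<Rightarrow> nat \<Rightarrow> nat" where
  "max_edges m n p = Max {card E | V E. ramsey_graph_of_order m n p V E}"

end

theory Submission
  imports Defs "HOL-Analysis.Convex"
begin

text \<open>
  Two adjacent vertices have at most \<open>R(m-2,n) - 1\<close> common neighbours and two distinct
  non-adjacent ones have at most \<open>R(m,n-2) - 1\<close> common non-neighbours. Hence the number of
  triangles plus the number of independent triples is bounded above linearly in the number \<open>e\<close>
  of edges, while Goodman's formula computes it from the degrees, and the Cauchy-Schwarz
  inequality turns this into a lower bound quadratic in \<open>e\<close>. Comparing the two gives
  \<open>(12 e - A)\<^sup>2 \<le> A\<^sup>2 - B\<close>. The other bounds come from bounding each degree.
\<close>

section \<open>Induced subgraphs and neighbourhoods in Ramsey graphs\<close>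

text \<open>A simple graph has no singleton among its edges, so \<open>v\<close> is excluded here
  automatically; among non-neighbours it has to be excluded by hand.\<close>

definition neighbours :: "'a set \<Rightarrow> 'a set set \<Rightarrow> 'a \<Rightarrow> 'a set" where
  "neighbours V E v = {u \<in> V. {u, v} \<in> E}"

definition nonneighbours :: "'a set \<Rightarrow> 'a set set \<Rightarrow> 'a \<Rightarrow> 'a set" where
  "nonneighbours V E v = {u \<in> V. u \<noteq> v \<and> {u, v} \<notin> E}"

text \<open>Cutting \<open>E\<close> down to \<open>nsets W 2\<close> makes the graph simple on
  \<open>W\<close> but changes no pair of distinct vertices of \<open>W\<close>, so a forbidden set
  in \<open>W\<close> would be forbidden in \<open>V\<close> already.\<close>

lemma ramsey_graph_induced:
  assumes "ramsey_graph m n V E" and "W \<subseteq> V"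
  shows "ramsey_graph m n W (E \<inter> nsets W 2)"
proof -
  have "clique S E" if "S \<subseteq> W" "clique S (E \<inter> nsets W 2)" for S
    using that by (auto simp: clique_def)
  moreover have "indep S E" if "S \<subseteq> W" "indep S (E \<inter> nsets W 2)" for S
    using that unfolding indep_def by (auto simp: subset_iff)
  moreover have "simple_graph W (E \<inter> nsets W 2)"
    using assms finite_subset by (auto simp: ramsey_graph_def simple_graph_def)
  moreover have "\<not> (\<exists>S \<subseteq> V. card S = m \<and> clique S E)" "\<not> (\<exists>S \<subseteq> V. card S = n \<and> indep S E)"
    using assms(1) by (auto simp only: ramsey_graph_def)
  moreover have "S \<subseteq> V" if "S \<subseteq> W" for S
    using that assms(2) by (rule subset_trans)
  ultimately show ?thesis
    unfolding ramsey_graph_def by metis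
qed

text \<open>Adding \<open>v\<close> to a clique of size \<open>m\<close> among its neighbours would
  give a clique of size \<open>Suc m\<close>. Applied twice, this controls common neighbourhoods of
  adjacent vertices.\<close>

lemma ramsey_graph_neighbours:
  assumes G: "ramsey_graph (Suc m) n V E" and v: "v \<in> V"
  shows "ramsey_graph m n (neighbours V E v) (E \<inter> nsets (neighbours V E v) 2)"
proof -
  let ?W = "neighbours V E v"
  have WV: "?W \<subseteq> V" by (auto simp: neighbours_def)
  have E: "E \<subseteq> nsets V 2" and fin: "finite V"
    using G by (auto simp: ramsey_graph_def simple_graph_def)
  then have vW: "v \<notin> ?W" by (auto simp: neighbours_def nsets_def)
  have "\<not> clique S (E \<inter> nsets ?W 2)" if S: "S \<subseteq> ?W" "card S = m" for S
  proof
    assume "clique S (E \<inter> nsets ?W 2)"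
    then have "clique (insert v S) E"
      using S by (auto simp: clique_def neighbours_def insert_commute)
    moreover have "card (insert v S) = Suc m"
      using S vW fin WV by (metis card_insert_disjoint finite_subset subsetD)
    moreover have "insert v S \<subseteq> V" using S WV v by auto
    ultimately show False using G unfolding ramsey_graph_def by blast
  qed
  moreover have "\<not> (\<exists>S \<subseteq> ?W. card S = n \<and> indep S (E \<inter> nsets ?W 2))"
    "simple_graph ?W (E \<inter> nsets ?W 2)"
    using ramsey_graph_induced [OF G WV] unfolding ramsey_graph_def by blast+
  ultimately show ?thesis unfolding ramsey_graph_def by blast
qed

text \<open>The complementary argument: \<open>v\<close> enlarges any independent set among its
  non-neighbours, so the second parameter drops.\<close>

lemma ramsey_graph_nonneighbours:
  assumes G: "ramsey_graph m (Suc n) V E" and v: "v \<in> V"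
  shows "ramsey_graph m n (nonneighbours V E v) (E \<inter> nsets (nonneighbours V E v) 2)"
proof -
  let ?W = "nonneighbours V E v"
  have WV: "?W \<subseteq> V" by (auto simp: nonneighbours_def)
  have fin: "finite V" using G by (auto simp: ramsey_graph_def simple_graph_def)
  have vW: "v \<notin> ?W" by (auto simp: nonneighbours_def)
  have "\<not> indep S (E \<inter> nsets ?W 2)" if S: "S \<subseteq> ?W" "card S = n" for S
  proof
    assume "indep S (E \<inter> nsets ?W 2)"
    then have "indep S E" using S(1) unfolding indep_def by (auto simp: subset_iff)
    then have "indep (insert v S) E"
      using S by (auto simp: indep_def nonneighbours_def insert_commute)
    moreover have "card (insert v S) = Suc n"
      using S vW fin WV by (metis card_insert_disjoint finite_subset subsetD)
    moreover have "insert v S \<subseteq> V" using S WV v by auto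
    ultimately show False using G unfolding ramsey_graph_def by blast
  qed
  moreover have "\<not> (\<exists>S \<subseteq> ?W. card S = m \<and> clique S (E \<inter> nsets ?W 2))"
    "simple_graph ?W (E \<inter> nsets ?W 2)"
    using ramsey_graph_induced [OF G WV] unfolding ramsey_graph_def by blast+
  ultimately show ?thesis unfolding ramsey_graph_def by blast
qed

section \<open>Ramsey numbers and the orders of Ramsey graphs\<close>

text \<open>Ramsey's theorem supplies some order \<open>r\<close> without such a graph, so the
  \<open>LEAST\<close> in the definition is attained.\<close>

lemma no_ramsey_graph_of_order_ramsey_number:
  "\<not> ramsey_graph_of_order m n (ramsey_number m n) V E"
proof -
  obtain r where r: "\<forall>(V::nat set) E. finite V \<and> card V \<ge> r \<longrightarrow>
      (\<exists>R \<subseteq> V. card R = m \<and> clique R E \<or> card R = n \<and> indep R E)"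
    using ramsey2 [where 'a = nat, of m n] by blast
  have "\<not> (\<exists>V E. ramsey_graph_of_order m n r V E)"
  proof clarify
    fix V E assume *: "ramsey_graph_of_order m n r V E"
    then have "finite V \<and> card V \<ge> r"
      by (auto simp: ramsey_graph_of_order_def ramsey_graph_def simple_graph_def)
    with r obtain R where "R \<subseteq> V" "card R = m \<and> clique R E \<or> card R = n \<and> indep R E"
      by blast
    with * show False
      by (auto simp: ramsey_graph_of_order_def ramsey_graph_def)
  qed
  then show ?thesis
    unfolding ramsey_number_def
    using LeastI [of "\<lambda>p. \<not> (\<exists>V E. ramsey_graph_of_order m n p V E)" r] by blast
qed

text \<open>The definition excludes only the order \<open>ramsey_number m n\<close> itself. A graph
  of larger order would have an induced subgraph of exactly that order.\<close>

lemma card_less_ramsey_number: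
  fixes V :: "nat set"
  assumes "ramsey_graph m n V E"
  shows "card V < ramsey_number m n"
proof (rule ccontr)
  assume "\<not> card V < ramsey_number m n"
  then obtain W where "W \<subseteq> V" "card W = ramsey_number m n"
    by (meson not_less obtain_subset_with_card_n)
  then show False
    using ramsey_graph_induced [OF assms] no_ramsey_graph_of_order_ramsey_number
    unfolding ramsey_graph_of_order_def by blast
qed

lemma ramsey_graph_of_order_exists:
  assumes "p < ramsey_number m n"
  shows "\<exists>V E. ramsey_graph_of_order m n p V E"
  using not_less_Least [OF assms [unfolded ramsey_number_def]] by blast

lemma finite_edge_counts: "finite {card E | V E. ramsey_graph_of_order m n p V E}"
proof (rule finite_subset)
  show "{card E | V E. ramsey_graph_of_order m n p V E} \<subseteq> {..p choose 2}"
    using card_mono [OF finite_imp_finite_nsets]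
    by (fastforce simp: ramsey_graph_of_order_def ramsey_graph_def simple_graph_def
        simp flip: card_nsets)
qed simp

section \<open>Degree sums and Goodman's formula\<close>

text \<open>Double counting of incidences: each edge has two ends, and the edges through
  \<open>v\<close> correspond to its neighbours by \<open>u\<close> to
  \<open>{u, v}\<close>.\<close>

lemma sum_card_neighbours:
  assumes "simple_graph V E"
  shows "(\<Sum>v\<in>V. card (neighbours V E v)) = 2 * card E"
proof -
  have fin: "finite V" and E: "E \<subseteq> nsets V 2"
    using assms by (auto simp: simple_graph_def)
  have finE: "finite E" using E fin finite_imp_finite_nsets finite_subset by blast
  have two: "card {v \<in> V. v \<in> e} = 2" if "e \<in> E" for e
  proof -
    have "{v \<in> V. v \<in> e} = e" "card e = 2" using that E by (auto simp: nsets_def)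
    then show ?thesis by simp
  qed
  have inc: "card (neighbours V E v) = card {e \<in> E. v \<in> e}" if "v \<in> V" for v
  proof (rule bij_betw_same_card [where f = "\<lambda>u. {u, v}"])
    show "bij_betw (\<lambda>u. {u, v}) (neighbours V E v) {e \<in> E. v \<in> e}"
      unfolding bij_betw_def
    proof (intro conjI equalityI subsetI)
      show "inj_on (\<lambda>u. {u, v}) (neighbours V E v)"
        by (auto simp: inj_on_def doubleton_eq_iff)
      fix e assume e: "e \<in> {e \<in> E. v \<in> e}"
      then obtain x y where "e = {x, y}" "x \<in> V" "y \<in> V"
        using E nsets2_E by (metis (no_types, lifting) mem_Collect_eq subsetD)
      with e obtain u where "u \<in> V" "e = {u, v}" by (auto simp: insert_commute)
      with e show "e \<in> (\<lambda>u. {u, v}) ` neighbours V E v" by (auto simp: neighbours_def)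
    qed (auto simp: neighbours_def)
  qed
  have "(\<Sum>v\<in>V. card (neighbours V E v)) = (\<Sum>v\<in>V. card {e \<in> E. v \<in> e})"
    using inc by simp
  also have "\<dots> = 2 * card E"
    using sum_multicount [OF fin finE, of "\<lambda>v e. v \<in> e" 2] two by simp
  finally show ?thesis .
qed

text \<open>
  Goodman's formula: for the adjacency matrix \<open>a\<close> of a graph and \<open>b\<close> of its complement, the left
  side counts each triangle and each independent triple six times.
\<close>

lemma goodman:
  fixes a b :: "'a \<Rightarrow> 'a \<Rightarrow> real"
  assumes fin: "finite V"
    and sym: "\<And>u v. a u v = a v u"
    and irrefl: "\<And>u. a u u = 0"
    and idem: "\<And>u v. a u v * a u v = a u v"
    and b: "\<And>u v. b u v = of_bool (u \<noteq> v) - a u v"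
    and d: "\<And>u. d u = (\<Sum>v\<in>V. a u v)"
  shows "(\<Sum>u\<in>V. \<Sum>v\<in>V. a u v * (\<Sum>w\<in>V. a u w * a v w))
       + (\<Sum>u\<in>V. \<Sum>v\<in>V. b u v * (\<Sum>w\<in>V. b u w * b v w))
       = real (card V) * (real (card V) - 1) * (real (card V) - 2)
         - 3 * (real (card V) - 1) * (\<Sum>u\<in>V. d u) + 3 * (\<Sum>u\<in>V. (d u)\<^sup>2)"
proof -
  let ?p = "real (card V)"
  \<comment> \<open>For \<open>u \<noteq> v\<close>, \<open>c u v\<close> counts the common
    neighbours; \<open>i\<close> is the identity matrix, so that the complement is
    \<open>1 - i - a\<close> entrywise.\<close>
  define c where "c u v = (\<Sum>w\<in>V. a u w * a v w)" for u v
  define i where "i u v = (of_bool (u = v) :: real)" for u v :: 'a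
  have b': "b u v = 1 - i u v - a u v" for u v by (simp add: b i_def)
  have i_sum: "(\<Sum>w\<in>V. i u w * f w) = f u" if "u \<in> V" for u and f :: "'a \<Rightarrow> real"
  proof -
    have "V \<inter> {w. u = w} = {u}" using that by auto
    then show ?thesis using fin by (simp add: i_def)
  qed
  have i_sum1: "(\<Sum>w\<in>V. i u w) = 1" if "u \<in> V" for u
    using i_sum [OF that, of "\<lambda>_. 1"] by simp
  have bb: "b u v * (\<Sum>w\<in>V. b u w * b v w) = b u v * (?p - 2 - d u - d v + c u v)"
    if uv: "u \<in> V" "v \<in> V" for u v
  proof (cases "u = v")
    case True
    then show ?thesis by (simp add: b irrefl)
  next
    case False
    have "(\<Sum>w\<in>V. b u w * b v w)
        = (\<Sum>w\<in>V. 1 - a u w - a v w - i u w - i v w + i u w * a v w + i v w * a u w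
             + i u w * i v w + a u w * a v w)"
      by (simp add: b' algebra_simps)
    also have "\<dots> = ?p - d u - d v - 1 - 1 + a v u + a u v + i v u + c u v"
      using uv by (simp add: sum.distrib sum_subtractf i_sum i_sum1 d c_def)
    also have "\<dots> = ?p - 2 - d u - d v + c u v + 2 * a u v"
      using False sym [of u v] by (simp add: i_def)
    finally have *: "(\<Sum>w\<in>V. b u w * b v w) = ?p - 2 - d u - d v + c u v + 2 * a u v" .
    \<comment> \<open>No pair is both an edge and a non-edge, so the factor \<open>b u v\<close>
      removes the extra term \<open>2 * a u v\<close>.\<close>
    have "b u v * a u v = 0" using False idem [of u v] by (simp add: b algebra_simps)
    then show ?thesis unfolding * by (simp add: algebra_simps)
  qed
  have b_sym: "b u v = b v u" for u v using sym [of u v] by (auto simp: b)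
  have b_row: "(\<Sum>v\<in>V. b u v) = ?p - 1 - d u" if "u \<in> V" for u
    using that by (simp add: b' sum_subtractf i_sum1 d)
  let ?S = "\<Sum>u\<in>V. (d u)\<^sup>2" and ?D = "\<Sum>u\<in>V. d u"
  have c_diag: "c u u = d u" for u by (simp add: c_def d idem)
  \<comment> \<open>Summing over the middle vertex \<open>w\<close> last, each \<open>w\<close>
    contributes all ordered pairs of its neighbours, equal ones included.\<close>
  have c_total: "(\<Sum>u\<in>V. \<Sum>v\<in>V. c u v) = ?S"
  proof -
    have "(\<Sum>u\<in>V. \<Sum>v\<in>V. c u v) = (\<Sum>u\<in>V. \<Sum>w\<in>V. \<Sum>v\<in>V. a u w * a v w)"
      unfolding c_def by (intro sum.cong refl sum.swap)
    also have "\<dots> = (\<Sum>w\<in>V. \<Sum>u\<in>V. \<Sum>v\<in>V. a u w * a v w)"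
      by (rule sum.swap)
    also have "\<dots> = (\<Sum>w\<in>V. \<Sum>u\<in>V. \<Sum>v\<in>V. a w u * a w v)"
      using sym by (intro sum.cong refl) metis
    also have "\<dots> = ?S"
      by (simp add: d power2_eq_square sum_product)
    finally show ?thesis .
  qed
  \<comment> \<open>The heart of the formula: \<open>a + b = 1 - i\<close>, so the triangle term and
    the \<open>c\<close> part of the complement's term merge into the off-diagonal sum of
    \<open>c\<close>, which the degrees determine.\<close>
  have ab: "a u v * c u v + b u v * c u v = c u v - i u v * c u v" for u v
    by (simp add: b' algebra_simps)
  have c_part: "(\<Sum>u\<in>V. \<Sum>v\<in>V. a u v * c u v) + (\<Sum>u\<in>V. \<Sum>v\<in>V. b u v * c u v) = ?S - ?D"
    by (simp add: sum.distrib [symmetric] ab sum_subtractf c_total i_sum c_diag)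
  have row_d: "(\<Sum>u\<in>V. \<Sum>v\<in>V. b u v * d u) = (?p - 1) * ?D - ?S"
  proof -
    have "(\<Sum>u\<in>V. \<Sum>v\<in>V. b u v * d u) = (\<Sum>u\<in>V. (?p - 1) * d u - (d u)\<^sup>2)"
      by (simp add: b_row left_diff_distrib power2_eq_square flip: sum_distrib_right)
    then show ?thesis by (simp add: sum_subtractf sum_distrib_left)
  qed
  have col_d: "(\<Sum>u\<in>V. \<Sum>v\<in>V. b u v * d v) = (?p - 1) * ?D - ?S"
  proof -
    have "(\<Sum>u\<in>V. \<Sum>v\<in>V. b u v * d v) = (\<Sum>v\<in>V. \<Sum>u\<in>V. b u v * d v)"
      by (rule sum.swap)
    also have "\<dots> = (\<Sum>v\<in>V. \<Sum>u\<in>V. b v u * d v)"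
      using b_sym by (intro sum.cong refl) metis
    finally have "(\<Sum>u\<in>V. \<Sum>v\<in>V. b u v * d v) = (\<Sum>v\<in>V. \<Sum>u\<in>V. b v u * d v)" .
    then show ?thesis using row_d by simp
  qed
  have b_total: "(\<Sum>u\<in>V. \<Sum>v\<in>V. b u v) = ?p * (?p - 1) - ?D"
    by (simp add: b_row sum_subtractf right_diff_distrib)
  have "(\<Sum>u\<in>V. \<Sum>v\<in>V. b u v * (\<Sum>w\<in>V. b u w * b v w))
      = (\<Sum>u\<in>V. \<Sum>v\<in>V. b u v * (?p - 2 - d u - d v + c u v))"
    by (intro sum.cong refl bb)
  also have "\<dots> = (\<Sum>u\<in>V. \<Sum>v\<in>V. (?p - 2) * b u v - b u v * d u - b u v * d v + b u v * c u v)"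
    by (simp add: algebra_simps)
  also have "\<dots> = (?p - 2) * (\<Sum>u\<in>V. \<Sum>v\<in>V. b u v) - (\<Sum>u\<in>V. \<Sum>v\<in>V. b u v * d u)
      - (\<Sum>u\<in>V. \<Sum>v\<in>V. b u v * d v) + (\<Sum>u\<in>V. \<Sum>v\<in>V. b u v * c u v)"
    by (simp only: sum.distrib sum_subtractf sum_distrib_left)
  finally show ?thesis
    using c_part unfolding row_d col_d b_total c_def [symmetric]
    by (simp add: algebra_simps)
qed

section \<open>Quadratic and degree bounds on the number of edges\<close>

text \<open>Completing the square: 12 times the left side of the hypothesis is
  \<open>(12 * x - A)\<^sup>2 - (A\<^sup>2 - B)\<close>.\<close>

lemma abs_diff_le_sqrt:
  fixes x A B :: real
  assumes "12 * x\<^sup>2 - 2 * A * x + B / 12 \<le> 0"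
  shows "(A - sqrt (A\<^sup>2 - B)) / 12 \<le> x" and "x \<le> (A + sqrt (A\<^sup>2 - B)) / 12"
proof -
  have "(12 * x - A)\<^sup>2 \<le> A\<^sup>2 - B"
    using assms by (simp add: power2_eq_square algebra_simps)
  then have "\<bar>12 * x - A\<bar> \<le> sqrt (A\<^sup>2 - B)"
    using real_le_rsqrt by fastforce
  then show "(A - sqrt (A\<^sup>2 - B)) / 12 \<le> x" and "x \<le> (A + sqrt (A\<^sup>2 - B)) / 12"
    by auto
qed

text \<open>Here \<open>m\<close> and \<open>n\<close> stand for the theorem's parameters less 2.
  The linear coefficient is then \<open>- 2 * A\<close> and the constant term
  \<open>B / 12\<close>.\<close>

lemma ramsey_graph_edge_quadratic:
  fixes V :: "nat set" and \<alpha> \<beta> :: real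
  assumes G: "ramsey_graph (m + 2) (n + 2) V E"
    and \<alpha>: "real (ramsey_number m (n + 2)) - 1 \<le> \<alpha>"
    and \<beta>: "real (ramsey_number (m + 2) n) - 1 \<le> \<beta>"
    and p: "p = real (card V)" and e: "e = real (card E)"
  shows "12 * e\<^sup>2 - 2 * ((\<alpha> - \<beta> + 3 * (p - 1)) * p) * e + p\<^sup>2 * (p - 1) * (p - \<beta> - 2) \<le> 0"
proof -
  have SG: "simple_graph V E" and fin: "finite V" and EV: "E \<subseteq> nsets V 2"
    using G by (auto simp: ramsey_graph_def simple_graph_def)
  define a where "a u v = (of_bool ({u, v} \<in> E) :: real)" for u v
  define b where "b u v = (of_bool (u \<noteq> v \<and> {u, v} \<notin> E) :: real)" for u v
  define d where "d u = (\<Sum>v\<in>V. a u v)" for u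
  have loop: "{u} \<notin> E" for u using EV by (auto simp: nsets_def)
  have d_card: "d u = real (card (neighbours V E u))" for u
    using fin by (simp add: d_def a_def neighbours_def Int_def insert_commute)
  have D: "(\<Sum>u\<in>V. d u) = 2 * e"
    using sum_card_neighbours [OF SG] by (simp add: d_card e flip: of_nat_sum)
  have a_bound: "(\<Sum>w\<in>V. a u w * a v w) \<le> \<alpha>" if uv: "u \<in> V" "v \<in> V" "{u, v} \<in> E" for u v
  proof -
    let ?W = "neighbours V E u"
    let ?F = "E \<inter> nsets ?W 2"
    \<comment> \<open>First pass to the neighbours of \<open>u\<close>, then to those of
      \<open>v\<close> inside that induced graph; what remains is the common neighbourhood.\<close>
    have "ramsey_graph (Suc m) (n + 2) ?W ?F"
      using ramsey_graph_neighbours [of "Suc m" "n + 2" V E u] G uv by simp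
    moreover have "v \<in> ?W" using uv by (simp add: neighbours_def insert_commute)
    ultimately have "card (neighbours ?W ?F v) < ramsey_number m (n + 2)"
      by (rule card_less_ramsey_number [OF ramsey_graph_neighbours])
    moreover have "neighbours ?W ?F v = V \<inter> {w. {u, w} \<in> E \<and> {v, w} \<in> E}"
      using uv loop by (auto simp: neighbours_def insert_commute)
    moreover have "(\<Sum>w\<in>V. a u w * a v w) = real (card (V \<inter> {w. {u, w} \<in> E \<and> {v, w} \<in> E}))"
      using fin by (simp add: a_def flip: of_bool_conj)
    ultimately show ?thesis using \<alpha> by simp
  qed
  have b_bound: "(\<Sum>w\<in>V. b u w * b v w) \<le> \<beta>"
    if uv: "u \<in> V" "v \<in> V" "u \<noteq> v" "{u, v} \<notin> E" for u v
  proof -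
    let ?W = "nonneighbours V E u"
    let ?F = "E \<inter> nsets ?W 2"
    have "ramsey_graph (m + 2) (Suc n) ?W ?F"
      using ramsey_graph_nonneighbours [of "m + 2" "Suc n" V E u] G uv by simp
    moreover have "v \<in> ?W" using uv by (simp add: nonneighbours_def insert_commute)
    ultimately have "card (nonneighbours ?W ?F v) < ramsey_number (m + 2) n"
      by (rule card_less_ramsey_number [OF ramsey_graph_nonneighbours])
    \<comment> \<open>For distinct vertices of \<open>?W\<close>, being a non-edge of
      \<open>?F\<close> is the same as being a non-edge of \<open>E\<close>.\<close>
    moreover have "nonneighbours ?W ?F v
        = V \<inter> {w. (u \<noteq> w \<and> {u, w} \<notin> E) \<and> (v \<noteq> w \<and> {v, w} \<notin> E)}"
      using uv by (auto simp: nonneighbours_def insert_commute)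
    moreover have "(\<Sum>w\<in>V. b u w * b v w)
        = real (card (V \<inter> {w. (u \<noteq> w \<and> {u, w} \<notin> E) \<and> (v \<noteq> w \<and> {v, w} \<notin> E)}))"
      using fin unfolding b_def by (simp only: flip: of_bool_conj) simp
    ultimately show ?thesis using \<beta> by simp
  qed
  have b_a: "b u v = of_bool (u \<noteq> v) - a u v" for u v
    using loop by (auto simp: a_def b_def)
  have a_total: "(\<Sum>u\<in>V. \<Sum>v\<in>V. a u v) = 2 * e" using D by (simp add: d_def)
  have b_total: "(\<Sum>u\<in>V. \<Sum>v\<in>V. b u v) = p * (p - 1) - 2 * e"
  proof -
    have "(\<Sum>v\<in>V. of_bool (u \<noteq> v)) = p - 1" if "u \<in> V" for u
    proof -
      have "V \<inter> {v. u \<noteq> v} = V - {u}" by auto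
      moreover have "card V > 0" using that fin card_gt_0_iff by blast
      ultimately show ?thesis using that fin by (simp add: p of_nat_diff)
    qed
    then show ?thesis by (simp add: b_a sum_subtractf a_total p)
  qed
  \<comment> \<open>Where \<open>a u v = 0\<close> both summands vanish, so the bound on common
    neighbours is called on for edges only and the sign of \<alpha> does not matter.\<close>
  have "(\<Sum>u\<in>V. \<Sum>v\<in>V. a u v * (\<Sum>w\<in>V. a u w * a v w)) \<le> (\<Sum>u\<in>V. \<Sum>v\<in>V. a u v * \<alpha>)"
    using a_bound by (intro sum_mono) (simp add: a_def [of u v for u v])
  also have "\<dots> = 2 * e * \<alpha>" by (simp add: a_total flip: sum_distrib_right)
  finally have aa: "(\<Sum>u\<in>V. \<Sum>v\<in>V. a u v * (\<Sum>w\<in>V. a u w * a v w)) \<le> 2 * e * \<alpha>" .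
  have "(\<Sum>u\<in>V. \<Sum>v\<in>V. b u v * (\<Sum>w\<in>V. b u w * b v w)) \<le> (\<Sum>u\<in>V. \<Sum>v\<in>V. b u v * \<beta>)"
    using b_bound by (intro sum_mono) (simp add: b_def [of u v for u v])
  also have "\<dots> = (p * (p - 1) - 2 * e) * \<beta>" by (simp add: b_total flip: sum_distrib_right)
  finally have bb: "(\<Sum>u\<in>V. \<Sum>v\<in>V. b u v * (\<Sum>w\<in>V. b u w * b v w))
      \<le> (p * (p - 1) - 2 * e) * \<beta>" .
  have good: "(\<Sum>u\<in>V. \<Sum>v\<in>V. a u v * (\<Sum>w\<in>V. a u w * a v w))
       + (\<Sum>u\<in>V. \<Sum>v\<in>V. b u v * (\<Sum>w\<in>V. b u w * b v w))
       = p * (p - 1) * (p - 2) - 3 * (p - 1) * (\<Sum>u\<in>V. d u) + 3 * (\<Sum>u\<in>V. (d u)\<^sup>2)"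
    unfolding p
    by (rule goodman [OF fin])
       (use loop b_a in \<open>auto simp: a_def d_def insert_commute\<close>)
  have "p * (p - 1) * (p - 2) - 6 * (p - 1) * e + 3 * (\<Sum>u\<in>V. (d u)\<^sup>2)
      \<le> 2 * e * \<alpha> + (p * (p - 1) - 2 * e) * \<beta>"
    using aa bb good by (simp add: D algebra_simps)
  \<comment> \<open>Multiplying by \<open>p\<close> lets the Cauchy-Schwarz inequality enter as
    \<open>(2 * e)\<^sup>2 \<le> (\<Sum>u\<in>V. (d u)\<^sup>2) * p\<close>, without a
    division.\<close>
  moreover have "p \<ge> 0" by (simp add: p)
  ultimately have "p * (p * (p - 1) * (p - 2) - 6 * (p - 1) * e + 3 * (\<Sum>u\<in>V. (d u)\<^sup>2))
      \<le> p * (2 * e * \<alpha> + (p * (p - 1) - 2 * e) * \<beta>)"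
    by (rule mult_left_mono)
  moreover have "(2 * e)\<^sup>2 \<le> (\<Sum>u\<in>V. (d u)\<^sup>2) * p"
    using sum_squared_le_sum_of_squares [of d V] by (simp add: D p)
  ultimately show ?thesis
    by (simp add: algebra_simps power2_eq_square)
qed

text \<open>The neighbourhood lemmas bound every degree from above and every number of
  non-neighbours likewise, which bounds the degree from below; summation then gives twice the number
  of edges.\<close>

lemma ramsey_graph_edge_bounds:
  fixes V :: "nat set"
  assumes G: "ramsey_graph (Suc m) (Suc n) V E"
  shows "2 * real (card E) \<le> real (card V) * (real (ramsey_number m (Suc n)) - 1)"
    and "real (card V) * (real (card V) - real (ramsey_number (Suc m) n)) \<le> 2 * real (card E)"
proof -
  have SG: "simple_graph V E" and fin: "finite V"
    using G by (auto simp: ramsey_graph_def simple_graph_def)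
  have sum: "(\<Sum>v\<in>V. real (card (neighbours V E v))) = 2 * real (card E)"
    using sum_card_neighbours [OF SG] by (simp flip: of_nat_sum)
  have "real (card (neighbours V E v)) \<le> real (ramsey_number m (Suc n)) - 1" if "v \<in> V" for v
    using card_less_ramsey_number [OF ramsey_graph_neighbours [OF G that]] by linarith
  then have "(\<Sum>v\<in>V. real (card (neighbours V E v)))
      \<le> (\<Sum>v\<in>V. real (ramsey_number m (Suc n)) - 1)"
    by (rule sum_mono)
  then show "2 * real (card E) \<le> real (card V) * (real (ramsey_number m (Suc n)) - 1)"
    by (simp add: sum)
  have "real (card V) - real (ramsey_number (Suc m) n) \<le> real (card (neighbours V E v))"
    if v: "v \<in> V" for v
  proof -
    have "V = insert v (neighbours V E v \<union> nonneighbours V E v)"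
      using v by (auto simp: neighbours_def nonneighbours_def)
    \<comment> \<open>The \<open>Suc\<close> accounts for \<open>v\<close> itself; it is absorbed by
      the strict inequality in \<open>card_less_ramsey_number\<close>.\<close>
    then have "card V \<le> Suc (card (neighbours V E v \<union> nonneighbours V E v))"
      using fin by (metis card_insert_le_m1 card_insert_if finite_insert le_SucI order_refl)
    also have "\<dots> \<le> Suc (card (neighbours V E v) + card (nonneighbours V E v))"
      using card_Un_le by auto
    finally show ?thesis
      using card_less_ramsey_number [OF ramsey_graph_nonneighbours [OF G v]] by linarith
  qed
  then have "(\<Sum>v\<in>V. real (card V) - real (ramsey_number (Suc m) n))
      \<le> (\<Sum>v\<in>V. real (card (neighbours V E v)))"
    by (rule sum_mono)
  then show "real (card V) * (real (card V) - real (ramsey_number (Suc m) n)) \<le> 2 * real (card E)"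
    by (simp add: sum)
qed

theorem theorem2:
  fixes m n p :: nat and \<alpha> \<beta> \<gamma> \<delta> :: int and A B :: real
  assumes "m \<ge> 3" and "n \<ge> 3" and "p \<ge> 1"
    and "int p \<le> int (ramsey_number m n) - 1"
    and "\<alpha> \<ge> int (ramsey_number (m - 2) n) - 1"
    and "\<beta> \<ge> int (ramsey_number m (n - 2)) - 1"
    and "\<gamma> \<ge> int (ramsey_number (m - 1) n) - 1"
    and "\<delta> \<ge> int (ramsey_number m (n - 1)) - 1"
    and "A = (real_of_int \<alpha> - real_of_int \<beta> + 3 * (real p - 1)) * real p"
    and "B = 12 * (real p)\<^sup>2 * (real p - 1) * (real p - real_of_int \<beta> - 2)"
  shows "real (min_edges m n p) \<ge>
           max (real p * (real p - real_of_int \<delta> - 1) / 2) ((A - sqrt (A\<^sup>2 - B)) / 12) \<and>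
         real (max_edges m n p) \<le>
           min (real p * real_of_int \<gamma> / 2) ((A + sqrt (A\<^sup>2 - B)) / 12)"
proof -
  have \<alpha>: "real (ramsey_number (m - 2) n) - 1 \<le> real_of_int \<alpha>"
    and \<beta>: "real (ramsey_number m (n - 2)) - 1 \<le> real_of_int \<beta>"
    and \<gamma>: "real (ramsey_number (m - 1) n) - 1 \<le> real_of_int \<gamma>"
    and \<delta>: "real (ramsey_number m (n - 1)) - 1 \<le> real_of_int \<delta>"
    using assms by linarith+
  \<comment> \<open>All four bounds hold for each single graph; the extremal counts are only
    inserted at the end.\<close>
  have bounds: "max (real p * (real p - real_of_int \<delta> - 1) / 2) ((A - sqrt (A\<^sup>2 - B)) / 12)
        \<le> real e \<and>
      real e \<le> min (real p * real_of_int \<gamma> / 2) ((A + sqrt (A\<^sup>2 - B)) / 12)"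
    if count: "e \<in> {card E | V E. ramsey_graph_of_order m n p V E}" for e
  proof -
    obtain V :: "nat set" and E where e: "e = card E" and G: "ramsey_graph m n V E" and p: "card V = p"
      using count unfolding ramsey_graph_of_order_def by blast
    \<comment> \<open>Subtraction on \<open>nat\<close> truncates, so these rewritings rest on the
      lower bounds on \<open>m\<close> and \<open>n\<close>.\<close>
    have m: "m - 2 + 2 = m" "n - 2 + 2 = n" "Suc (m - 1) = m" "Suc (n - 1) = n"
      using assms(1,2) by auto
    have "12 * (real e)\<^sup>2 - 2 * A * real e + B / 12 \<le> 0"
      using ramsey_graph_edge_quadratic
        [of "m - 2" "n - 2" V E "real_of_int \<alpha>" "real_of_int \<beta>" "real p" "real e"]
        G \<alpha> \<beta> e p assms(9,10) by (simp only: m) simp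
    note quad = abs_diff_le_sqrt [OF this]
    have "2 * real e \<le> real p * (real (ramsey_number (m - 1) n) - 1)"
      and "real p * (real p - real (ramsey_number m (n - 1))) \<le> 2 * real e"
      using ramsey_graph_edge_bounds [of "m - 1" "n - 1" V E] G e p by (simp_all only: m)
    moreover have "real p * (real (ramsey_number (m - 1) n) - 1) \<le> real p * real_of_int \<gamma>"
      using \<gamma> by (intro mult_left_mono) auto
    moreover have "real p * (real p - real_of_int \<delta> - 1)
        \<le> real p * (real p - real (ramsey_number m (n - 1)))"
      using \<delta> by (intro mult_left_mono) auto
    ultimately show ?thesis using quad by simp
  qed
  \<comment> \<open>A graph of order \<open>p\<close> therefore exists, and the finite nonempty set
    of edge counts contains its own \<open>Min\<close> and \<open>Max\<close>, to which
    \<open>bounds\<close> applies.\<close>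
  have "p < ramsey_number m n" using assms(4) by linarith
  then have "{card E | V E. ramsey_graph_of_order m n p V E} \<noteq> {}"
    using ramsey_graph_of_order_exists by blast
  then show ?thesis
    unfolding min_edges_def max_edges_def
    using bounds [OF Min_in [OF finite_edge_counts]] bounds [OF Max_in [OF finite_edge_counts]]
    by blast
qed

end
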